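(* Let $d\ge2$ and let $A=(a_{ij}(X))$ be a real symmetric $(d+1)\times(d+1)$ matrix of functions on $\mathbb{R}^{d+1}$ with $\mu|\xi|^2\le a_{ij}(X)\xi_i\xi_j\le\mu^{-1}|\xi|^2$ for all $X,\xi\in\mathbb{R}^{d+1}$, for some $\mu>0$; let $\mathcal{L}=-\mathrm{div}(A\nabla)$. Let $\Omega\subset\mathbb{R}^{d+1}$ be a bounded Lipschitz domain and $u\in W^{1,2}(\Omega)$ a variational solution to the Neumann problem $\mathcal{L}(u)=0$ in $\Omega$, $\frac{\partial u}{\partial\nu}=g\in L^2(\partial\Omega)$. Assume that $u\in W^{1,2}(\Omega_1)$, where $\Omega_1$ contains $\Omega$ and $\{(x,t+1):(x,t)\in\Omega\}$. Then $$-\int_\Omega a_{ij}\,Q\Big(\frac{\partial u}{\partial x_i}\cdot\frac{\partial u}{\partial x_j}\Big)dX+\int_\Omega a_{ij}\,Q\Big(\frac{\partial u}{\partial x_i}\Big)\cdot Q\Big(\frac{\partial u}{\partial x_j}\Big)dX=-2\int_{\partial\Omega}g\,Q(u)\,d\sigma,$$ where the indices $i,j$ are summed from $1$ to $d+1$ and $x_{d+1}$ is identified with $t$.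
   Context: Write $X=(x,t)\in\mathbb{R}^d\times\mathbb{R}$. The difference operator $Q$ is $Q(v)(x,t)=v(x,t+1)-v(x,t)$. A variational solution of the Neumann problem is a function $u\in W^{1,2}(\Omega)$ with $\int_\Omega a_{ij}\frac{\partial u}{\partial x_j}\frac{\partial\varphi}{\partial x_i}\,dX=\int_{\partial\Omega}g\varphi\,d\sigma$ for all $\varphi\in W^{1,2}(\Omega)$, where $\varphi$ on $\partial\Omega$ is the trace and $d\sigma$ is surface measure. *)

theory Defs
  imports "HOL-Analysis.Analysis"
begin

text \<open>
  Functions on a set are represented by total functions of which only the values on that set
  matter; the components of a vector are indexed by the standard orthonormal basis \<^term>\<open>Basis\<close>.
\<close>

section \<open>Square-integrable functions and weak derivatives\<close>

definition L2 :: "'a measure \<Rightarrow> ('a \<Rightarrow> real) set" where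
  "L2 M = {f \<in> borel_measurable M. integrable M (\<lambda>x. (f x)\<^sup>2)}"

definition L2_norm :: "'a measure \<Rightarrow> ('a \<Rightarrow> real) \<Rightarrow> real" where
  "L2_norm M f = sqrt (LINT x|M. (f x)\<^sup>2)"

definition locally_integrable :: "'a::euclidean_space set \<Rightarrow> ('a \<Rightarrow> real) \<Rightarrow> bool" where
  "locally_integrable \<Omega> f \<longleftrightarrow>
     f \<in> borel_measurable (lebesgue_on \<Omega>) \<and>
     (\<forall>K. compact K \<and> K \<subseteq> \<Omega> \<longrightarrow> f absolutely_integrable_on K)"

definition partial_deriv :: "'a::euclidean_space \<Rightarrow> ('a \<Rightarrow> real) \<Rightarrow> 'a \<Rightarrow> real" where
  "partial_deriv i f x = frechet_derivative f (at x) i"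

primrec Ck :: "nat \<Rightarrow> ('a::euclidean_space \<Rightarrow> real) \<Rightarrow> bool" where
  "Ck 0 f \<longleftrightarrow> continuous_on UNIV f"
| "Ck (Suc k) f \<longleftrightarrow> (\<forall>x. f differentiable (at x)) \<and> (\<forall>i\<in>Basis. Ck k (partial_deriv i f))"

definition smooth :: "('a::euclidean_space \<Rightarrow> real) \<Rightarrow> bool" where
  "smooth f \<longleftrightarrow> (\<forall>k. Ck k f)"

definition test_functions :: "'a::euclidean_space set \<Rightarrow> ('a \<Rightarrow> real) set" where
  "test_functions \<Omega> =
     {\<phi>. smooth \<phi> \<and> (\<exists>K. compact K \<and> K \<subseteq> \<Omega> \<and> (\<forall>x. x \<notin> K \<longrightarrow> \<phi> x = 0))}"

definition has_weak_pderiv ::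
  "'a::euclidean_space set \<Rightarrow> 'a \<Rightarrow> ('a \<Rightarrow> real) \<Rightarrow> ('a \<Rightarrow> real) \<Rightarrow> bool" where
  "has_weak_pderiv \<Omega> i u v \<longleftrightarrow>
     locally_integrable \<Omega> u \<and> locally_integrable \<Omega> v \<and>
     (\<forall>\<phi>\<in>test_functions \<Omega>.
        (LINT x|lebesgue_on \<Omega>. u x * partial_deriv i \<phi> x) = - (LINT x|lebesgue_on \<Omega>. v x * \<phi> x))"

text \<open>A representative of the weak derivative; on an open set it is unique up to null sets.\<close>

definition weak_pderiv ::
  "'a::euclidean_space set \<Rightarrow> 'a \<Rightarrow> ('a \<Rightarrow> real) \<Rightarrow> 'a \<Rightarrow> real" where
  "weak_pderiv \<Omega> i u = (SOME v. has_weak_pderiv \<Omega> i u v)"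

definition W12 :: "'a::euclidean_space set \<Rightarrow> ('a \<Rightarrow> real) set" where
  "W12 \<Omega> = {u \<in> L2 (lebesgue_on \<Omega>).
     \<forall>i\<in>Basis. \<exists>v\<in>L2 (lebesgue_on \<Omega>). has_weak_pderiv \<Omega> i u v}"

definition W12_norm :: "'a::euclidean_space set \<Rightarrow> ('a \<Rightarrow> real) \<Rightarrow> real" where
  "W12_norm \<Omega> u =
     sqrt ((L2_norm (lebesgue_on \<Omega>) u)\<^sup>2 +
           (\<Sum>i\<in>Basis. (L2_norm (lebesgue_on \<Omega>) (weak_pderiv \<Omega> i u))\<^sup>2))"


section \<open>Surface measure\<close>

text \<open>
  Surface measure is the Hausdorff measure of codimension one. The factor \<^term>\<open>unit_ball_vol\<close>
  normalises the \<open>k\<close>-dimensional Hausdorff measure (\<open>k \<ge> 1\<close>) so that it agrees with Lebesgue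
  measure on \<open>k\<close>-dimensional planes. The covering sets have to be bounded because
  \<^term>\<open>diameter\<close> is a real number, without meaning for unbounded sets.
\<close>

definition hausdorff_content :: "nat \<Rightarrow> real \<Rightarrow> 'a::euclidean_space set \<Rightarrow> ennreal" where
  "hausdorff_content k \<delta> E =
     (INF C \<in> {C :: nat \<Rightarrow> 'a set. E \<subseteq> (\<Union>n. C n) \<and> (\<forall>n. bounded (C n) \<and> diameter (C n) \<le> \<delta>)}.
        \<Sum>n. ennreal (unit_ball_vol (real k) * (diameter (C n) / 2) ^ k))"

definition hausdorff_outer :: "nat \<Rightarrow> 'a::euclidean_space set \<Rightarrow> ennreal" where
  "hausdorff_outer k E = (SUP \<delta>\<in>{0<..}. hausdorff_content k \<delta> E)"

text \<open>The measure lives on the Caratheodory-measurable sets, given by \<^term>\<open>lambda_system\<close>.\<close>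

definition hausdorff_measure :: "nat \<Rightarrow> 'a::euclidean_space measure" where
  "hausdorff_measure k =
     measure_of UNIV (lambda_system UNIV UNIV (hausdorff_outer k)) (hausdorff_outer k)"

definition surface_measure :: "'a::euclidean_space set \<Rightarrow> 'a measure" where
  "surface_measure \<Omega> = restrict_space (hausdorff_measure (DIM('a) - 1)) (frontier \<Omega>)"


section \<open>Lipschitz domains and traces\<close>

text \<open>
  Near each boundary point \<open>p\<close>, in the orthogonal coordinates given by a unit vector \<open>\<nu>\<close>, the
  domain is the part above the graph of a Lipschitz function on the hyperplane orthogonal to \<open>\<nu>\<close>.
\<close>

definition bounded_Lipschitz_domain :: "'a::euclidean_space set \<Rightarrow> bool" where
  "bounded_Lipschitz_domain \<Omega> \<longleftrightarrow>
     open \<Omega> \<and> connected \<Omega> \<and> \<Omega> \<noteq> {} \<and> bounded \<Omega> \<and>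
     (\<forall>p\<in>frontier \<Omega>. \<exists>\<nu> r L \<psi>.
        norm \<nu> = 1 \<and> r > 0 \<and> L-lipschitz_on {y. y \<bullet> \<nu> = 0} (\<psi> :: 'a \<Rightarrow> real) \<and>
        \<Omega> \<inter> ball p r =
          {x \<in> ball p r. (x - p) \<bullet> \<nu> > \<psi> ((x - p) - ((x - p) \<bullet> \<nu>) *\<^sub>R \<nu>)})"

text \<open>
  The trace operator is the continuous extension to \<open>W\<^sup>1\<^sup>,\<^sup>2(\<Omega>)\<close> of the restriction of smooth
  functions to the boundary. On a bounded Lipschitz domain every function in \<open>W\<^sup>1\<^sup>,\<^sup>2(\<Omega>)\<close> has a
  trace, unique up to null sets of the surface measure.
\<close>

definition has_boundary_trace ::
  "'a::euclidean_space set \<Rightarrow> ('a \<Rightarrow> real) \<Rightarrow> ('a \<Rightarrow> real) \<Rightarrow> bool" where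
  "has_boundary_trace \<Omega> u f \<longleftrightarrow>
     u \<in> W12 \<Omega> \<and> f \<in> L2 (surface_measure \<Omega>) \<and>
     (\<exists>\<phi> :: nat \<Rightarrow> 'a \<Rightarrow> real. (\<forall>n. smooth (\<phi> n)) \<and>
        (\<lambda>n. W12_norm \<Omega> (\<lambda>x. \<phi> n x - u x)) \<longlonglongrightarrow> 0 \<and>
        (\<lambda>n. L2_norm (surface_measure \<Omega>) (\<lambda>x. \<phi> n x - f x)) \<longlonglongrightarrow> 0)"

definition boundary_trace ::
  "'a::euclidean_space set \<Rightarrow> ('a \<Rightarrow> real) \<Rightarrow> 'a \<Rightarrow> real" where
  "boundary_trace \<Omega> u = (SOME f. has_boundary_trace \<Omega> u f)"


section \<open>The Neumann problem and the difference operator\<close>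

text \<open>The entry \<open>a\<^sub>i\<^sub>j(X)\<close> of the coefficient matrix is \<open>a i j X\<close> with \<open>i, j \<in> Basis\<close>.\<close>

definition variational_solution ::
  "('a::euclidean_space \<Rightarrow> 'a \<Rightarrow> 'a \<Rightarrow> real) \<Rightarrow> 'a set \<Rightarrow> ('a \<Rightarrow> real) \<Rightarrow> ('a \<Rightarrow> real) \<Rightarrow> bool" where
  "variational_solution a \<Omega> g u \<longleftrightarrow>
     u \<in> W12 \<Omega> \<and>
     (\<forall>\<phi>\<in>W12 \<Omega>.
        (LINT X|lebesgue_on \<Omega>.
           (\<Sum>i\<in>Basis. \<Sum>j\<in>Basis. a i j X * weak_pderiv \<Omega> j u X * weak_pderiv \<Omega> i \<phi> X)) =
        (LINT X|surface_measure \<Omega>. g X * boundary_trace \<Omega> \<phi> X))"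

definition shift_diff :: "('b \<times> real \<Rightarrow> real) \<Rightarrow> 'b \<times> real \<Rightarrow> real" where
  "shift_diff v = (\<lambda>(x, t). v (x, t + 1) - v (x, t))"

end

theory Submission
  imports Defs "HOL-Computational_Algebra.Polynomial"
begin

text \<open>
  Write \<open>Q\<close> for \<^const>\<open>shift_diff\<close> and \<open>\<partial>\<^sub>i\<close> for weak derivatives. The discrete product rule
  \<open>Q(vw) = Qv Qw + w Qv + v Qw\<close>, applied to \<open>\<partial>\<^sub>i u\<close> and \<open>\<partial>\<^sub>j u\<close> and contracted with the symmetric
  matrix \<open>a\<close>, gives the pointwise identity
  \<open>- a\<^sub>i\<^sub>j Q(\<partial>\<^sub>i u \<partial>\<^sub>j u) + a\<^sub>i\<^sub>j Q(\<partial>\<^sub>i u) Q(\<partial>\<^sub>j u) = - 2 a\<^sub>i\<^sub>j \<partial>\<^sub>j u Q(\<partial>\<^sub>i u)\<close>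
  (\<open>shift_diff_quadratic_form\<close>). Since \<open>Q(\<partial>\<^sub>i u) = \<partial>\<^sub>i (Q u)\<close>, the right-hand side is \<open>-2\<close> times the
  integrand of the weak formulation of the Neumann problem with \<open>Q u\<close> as the test function, which
  equals the boundary integral of \<open>g\<close> against the trace of \<open>Q u\<close>.

  Two points need care. The integrals may be split only if both integrands on the left are
  integrable; they are, because the entries of \<open>a\<close> are bounded by ellipticity
  (\<open>bounded_coefficients\<close>) and the derivatives are square integrable. Moreover, three weak
  derivatives are in play: those of \<open>u\<close> on \<open>\<Omega>1\<close>, of \<open>u\<close> on \<open>\<Omega>\<close> and of \<open>Q u\<close> on \<open>\<Omega>\<close>, each an
  arbitrary choice of a representative. They are compared by showing that translates, restrictions
  and differences of weak derivatives are weak derivatives (\<open>has_weak_pderiv_translation\<close>,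
  \<open>has_weak_pderiv_diff\<close>) and that weak derivatives are unique almost everywhere.

  Uniqueness (\<open>has_weak_pderiv_unique\<close>) is the fundamental lemma of the calculus of variations, and
  requires sufficiently many test functions. Products of functions \<open>e\<^sup>-\<^sup>c\<^sup>/\<^sup>y\<close>, one for each face of a
  box, serve: as \<open>c\<close> tends to \<open>0\<close> they approach the indicator of the box, so that a function
  orthogonal to all test functions has vanishing integrals over boxes, and the Lebesgue
  differentiation theorem shows that it vanishes almost everywhere.
\<close>

section \<open>Calculus of \<open>C\<^sup>k\<close> functions\<close>

lemma partial_deriv_eq:
  assumes "(f has_derivative D) (at x)"
  shows "partial_deriv i f x = D i"
  using frechet_derivative_at[OF assms] by (simp add: partial_deriv_def)

lemma Ck_imp_continuous: "Ck k f \<Longrightarrow> continuous_on UNIV f"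
  by (cases k) (auto simp: continuous_on_eq_continuous_at intro: differentiable_imp_continuous_within)

lemma Ck_Suc_imp_Ck: "Ck (Suc k) f \<Longrightarrow> Ck k f"
proof (induction k arbitrary: f)
  case 0
  then show ?case using Ck_imp_continuous[of "Suc 0" f] by simp
next
  case (Suc k)
  then show ?case by (metis Ck.simps(2))
qed

lemma Ck_const: "Ck k (\<lambda>x. c)"
proof (induction k arbitrary: c)
  case (Suc k)
  have "partial_deriv i (\<lambda>x. c) = (\<lambda>x. 0)" for i :: 'a
    using partial_deriv_eq[OF has_derivative_const] by auto
  then show ?case using Suc by simp
qed simp

lemma Ck_add: "Ck k f \<Longrightarrow> Ck k g \<Longrightarrow> Ck k (\<lambda>x. f x + g x)"
proof (induction k arbitrary: f g)
  case (Suc k)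
  have "partial_deriv i (\<lambda>x. f x + g x) = (\<lambda>x. partial_deriv i f x + partial_deriv i g x)" (is "?l = ?r") for i
  proof
    fix x
    have "(f has_derivative frechet_derivative f (at x)) (at x)"
      "(g has_derivative frechet_derivative g (at x)) (at x)"
      using Suc.prems by (simp_all add: frechet_derivative_works)
    from partial_deriv_eq[OF has_derivative_add[OF this]]
    show "?l x = ?r x" by (simp add: partial_deriv_def)
  qed
  then show ?case using Suc by simp
qed (simp add: continuous_on_add)

lemma Ck_mult: "Ck k f \<Longrightarrow> Ck k g \<Longrightarrow> Ck k (\<lambda>x. f x * g x)"
proof (induction k arbitrary: f g)
  case (Suc k)
  have "partial_deriv i (\<lambda>x. f x * g x) =
      (\<lambda>x. f x * partial_deriv i g x + partial_deriv i f x * g x)" (is "?l = ?r") for i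
  proof
    fix x
    have "(f has_derivative frechet_derivative f (at x)) (at x)"
      "(g has_derivative frechet_derivative g (at x)) (at x)"
      using Suc.prems by (simp_all add: frechet_derivative_works)
    from partial_deriv_eq[OF has_derivative_mult[OF this]]
    show "?l x = ?r x" by (simp add: partial_deriv_def)
  qed
  then show ?case using Suc Ck_Suc_imp_Ck[OF Suc.prems(1)] Ck_Suc_imp_Ck[OF Suc.prems(2)]
    by (simp add: Ck_add)
qed (simp add: continuous_on_mult)

lemma Ck_prod: "(\<And>b. b \<in> B \<Longrightarrow> Ck k (f b)) \<Longrightarrow> Ck k (\<lambda>x. \<Prod>b\<in>B. f b x)"
  by (induction B rule: infinite_finite_induct) (simp_all add: Ck_mult Ck_const del: Ck.simps)

lemma has_derivative_translate:
  assumes "f differentiable (at (c + x))"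
  shows "((\<lambda>y. f (c + y)) has_derivative frechet_derivative f (at (c + x))) (at x)"
proof -
  have "((\<lambda>y. c + y) has_derivative (\<lambda>h. h)) (at x)"
    by (auto intro!: derivative_eq_intros)
  from diff_chain_at[OF this, of f "frechet_derivative f (at (c + x))"] assms
  show ?thesis by (simp add: frechet_derivative_works o_def)
qed

lemma Ck_translate: "Ck k f \<Longrightarrow> Ck k (\<lambda>x. f (c + x))"
proof (induction k arbitrary: f)
  case 0
  then show ?case by (auto intro!: continuous_on_compose2[where f="\<lambda>x. c + x" and g=f and t=UNIV] continuous_intros)
next
  case (Suc k)
  have d: "((\<lambda>y. f (c + y)) has_derivative frechet_derivative f (at (c + x))) (at x)" for x
    using Suc.prems by (intro has_derivative_translate) auto
  have "partial_deriv i (\<lambda>x. f (c + x)) = (\<lambda>x. partial_deriv i f (c + x))" for i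
    using partial_deriv_eq[OF d] by (auto simp: partial_deriv_def)
  then show ?case using Suc d by (auto simp: differentiable_def)
qed

section \<open>Smooth bump functions on boxes\<close>

text \<open>
  The functions \<open>p(1/x) e\<^sup>-\<^sup>c\<^sup>/\<^sup>x\<close> on the right half line, extended by \<open>0\<close>. The polynomial \<open>p\<close> is a
  parameter because the family is then closed under differentiation, which makes smoothness a
  plain induction.
\<close>

definition flat :: "real \<Rightarrow> real poly \<Rightarrow> real \<Rightarrow> real" where
  "flat c p x = (if x > 0 then poly p (1 / x) * exp (- c / x) else 0)"

lemma poly_times_exp_tendsto_0:
  fixes p :: "real poly"
  assumes "c > 0"
  shows "((\<lambda>y. poly p y * exp (- c * y)) \<longlongrightarrow> 0) at_top"
proof -
  have mono: "((\<lambda>y. y ^ k * exp (- c * y)) \<longlongrightarrow> 0) at_top" for k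
  proof -
    have "filterlim (\<lambda>y. c * y) at_top at_top"
      using assms by (intro filterlim_tendsto_pos_mult_at_top[OF tendsto_const]) (auto intro: filterlim_ident)
    from filterlim_compose[OF tendsto_power_div_exp_0 this]
    have "((\<lambda>y. inverse (c ^ k) * ((c * y) ^ k / exp (c * y))) \<longlongrightarrow> 0) at_top"
      by (intro tendsto_mult_right_zero)
    moreover have "inverse (c ^ k) * ((c * y) ^ k / exp (c * y)) = y ^ k * exp (- c * y)" for y
      using assms by (simp add: exp_minus field_simps power_mult_distrib)
    ultimately show ?thesis by simp
  qed
  have "((\<lambda>y. \<Sum>i\<le>degree p. coeff p i * (y ^ i * exp (- c * y))) \<longlongrightarrow> 0) at_top"
    using mono by (intro tendsto_null_sum tendsto_mult_right_zero)
  then show ?thesis by (simp add: poly_altdef sum_distrib_right mult.assoc)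
qed

lemma flat_tendsto_0:
  assumes "c > 0"
  shows "(flat c p \<longlongrightarrow> 0) (at 0)"
proof -
  have "((\<lambda>x. poly p (inverse x) * exp (- c * inverse x)) \<longlongrightarrow> 0) (at_right 0)"
    by (rule filterlim_compose[OF poly_times_exp_tendsto_0[OF assms] filterlim_inverse_at_top_right])
  then have "(flat c p \<longlongrightarrow> 0) (at_right 0)"
    by (rule Lim_transform_eventually)
      (auto simp: flat_def eventually_at_right_less inverse_eq_divide intro!: eventually_at_rightI[of 0 1])
  moreover have "(flat c p \<longlongrightarrow> 0) (at_left 0)"
    by (rule tendsto_eventually) (auto simp: flat_def intro!: eventually_at_leftI[of "-1" 0])
  ultimately show ?thesis by (simp add: filterlim_at_split)
qed

text \<open>
  The polynomial of the derivative is \<open>y\<^sup>2 (c p(y) - p'(y))\<close>, from \<open>dy/dx = -y\<^sup>2\<close> for \<open>y = 1/x\<close>.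
  At the origin the difference quotient is again a function of the family, with polynomial
  \<open>y p(y)\<close>, and therefore tends to \<open>0\<close>.
\<close>

lemma flat_has_derivative:
  assumes "c > 0"
  shows "(flat c p has_real_derivative flat c ([:0, 0, 1:] * (smult c p - pderiv p)) x) (at x)"
proof -
  consider "x < 0" | "x = 0" | "x > 0" by linarith
  then show ?thesis
  proof cases
    case 1
    have "((\<lambda>x. 0) has_real_derivative 0) (at x)" by simp
    then have "(flat c p has_real_derivative 0) (at x)"
      by (rule has_field_derivative_transform_within_open[where S="{..<0}"]) (use 1 in \<open>simp_all add: flat_def\<close>)
    then show ?thesis using 1 by (simp add: flat_def)
  next
    case 2
    have "(\<lambda>h. (flat c p h - flat c p 0) / (h - 0)) = flat c ([:0, 1:] * p)"
      by (auto simp: flat_def fun_eq_iff)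
    then show ?thesis
      using flat_tendsto_0[OF assms] 2 by (simp add: has_field_derivative_iff flat_def)
  next
    case 3
    have "((\<lambda>x. 1 / x) has_real_derivative - (1 / x)\<^sup>2) (at x)"
      using 3 by (auto intro!: derivative_eq_intros simp: field_simps power2_eq_square)
    from DERIV_chain2[OF poly_DERIV this, of p]
      DERIV_chain2[OF DERIV_exp DERIV_cmult[OF this, of "- c"]]
    have "((\<lambda>x. poly p (1 / x) * exp (- c * (1 / x))) has_real_derivative
        poly (pderiv p) (1 / x) * - (1 / x)\<^sup>2 * exp (- c * (1 / x)) +
        exp (- c * (1 / x)) * (- c * - (1 / x)\<^sup>2) * poly p (1 / x)) (at x)"
      by (rule DERIV_mult)
    then have "((\<lambda>x. poly p (1 / x) * exp (- c / x)) has_real_derivative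
        poly ([:0, 0, 1:] * (smult c p - pderiv p)) (1 / x) * exp (- c / x)) (at x)"
      by (simp add: algebra_simps power2_eq_square)
    then have "(flat c p has_real_derivative
        poly ([:0, 0, 1:] * (smult c p - pderiv p)) (1 / x) * exp (- c / x)) (at x)"
      by (rule has_field_derivative_transform_within_open[where S="{0<..}"]) (use 3 in \<open>simp_all add: flat_def\<close>)
    then show ?thesis using 3 by (simp add: flat_def)
  qed
qed

lemma Ck_flat_affine:
  assumes "c > 0"
  shows "Ck k (\<lambda>x::'a::euclidean_space. flat c p (s * (x \<bullet> b) + r))"
proof (induction k arbitrary: p)
  case 0
  have "continuous_on UNIV (flat c p)"
    using flat_has_derivative[OF assms] by (intro DERIV_continuous_on) auto
  then show ?case
    by (auto intro!: continuous_on_compose2[where g="flat c p" and t=UNIV] continuous_intros)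
next
  case (Suc k)
  let ?q = "[:0, 0, 1:] * (smult c p - pderiv p)"
  have d: "((\<lambda>x. flat c p (s * (x \<bullet> b) + r)) has_derivative
      (\<lambda>h. flat c ?q (s * (x \<bullet> b) + r) * (s * (h \<bullet> b)))) (at x)" for x
  proof -
    have "((\<lambda>x. s * (x \<bullet> b) + r) has_derivative (\<lambda>h. s * (h \<bullet> b))) (at x)"
      by (auto intro!: derivative_eq_intros)
    from diff_chain_at[OF this flat_has_derivative[OF assms, THEN has_field_derivative_imp_has_derivative]]
    show ?thesis by (simp add: o_def)
  qed
  have "partial_deriv i (\<lambda>x. flat c p (s * (x \<bullet> b) + r)) =
      (\<lambda>x. flat c ?q (s * (x \<bullet> b) + r) * (s * (i \<bullet> b)))" for i
    using partial_deriv_eq[OF d] by auto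
  then show ?case using d Suc by (auto simp: differentiable_def intro!: Ck_mult Ck_const)
qed

text \<open>
  One factor for each face of the box: \<open>e\<^sup>-\<^sup>c\<^sup>/\<^sup>y\<close> at distance \<open>y\<close> on the inner side of the face and
  \<open>0\<close> on the outer side. Letting \<open>c\<close> tend to \<open>0\<close> gives the indicator function of the open box.
\<close>

definition box_bump :: "real \<Rightarrow> 'a::euclidean_space \<Rightarrow> 'a \<Rightarrow> 'a \<Rightarrow> real" where
  "box_bump c l r x = (\<Prod>b\<in>Basis. flat c 1 (x \<bullet> b - l \<bullet> b) * flat c 1 (r \<bullet> b - x \<bullet> b))"

lemma smooth_box_bump:
  assumes "c > 0"
  shows "smooth (box_bump c l r)"
proof -
  have "Ck k (\<lambda>x. flat c 1 (1 * (x \<bullet> b) + - (l \<bullet> b)))" "Ck k (\<lambda>x. flat c 1 ((-1) * (x \<bullet> b) + r \<bullet> b))"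
    for k and b :: 'a
    by (rule Ck_flat_affine[OF assms])+
  then show ?thesis
    unfolding smooth_def box_bump_def by (intro allI Ck_prod Ck_mult) simp_all
qed

lemma box_bump_eq_0:
  assumes "x \<notin> box l r"
  shows "box_bump c l r x = 0"
proof -
  obtain b where b: "b \<in> Basis" "\<not> (l \<bullet> b < x \<bullet> b \<and> x \<bullet> b < r \<bullet> b)"
    using assms by (auto simp: mem_box)
  then have "flat c 1 (x \<bullet> b - l \<bullet> b) * flat c 1 (r \<bullet> b - x \<bullet> b) = 0"
    by (auto simp: flat_def)
  then show ?thesis
    using b(1) by (auto simp: box_bump_def)
qed

lemma box_bump_test_function:
  assumes "c > 0" "cbox l r \<subseteq> \<Omega>"
  shows "box_bump c l r \<in> test_functions \<Omega>"
proof -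
  have "\<forall>x. x \<notin> cbox l r \<longrightarrow> box_bump c l r x = 0"
    using box_bump_eq_0 box_subset_cbox by blast
  then show ?thesis
    using assms smooth_box_bump[of c l r] compact_cbox[of l r] unfolding test_functions_def by blast
qed

lemma abs_box_bump_le_1: "c > 0 \<Longrightarrow> \<bar>box_bump c l r x\<bar> \<le> 1"
  unfolding box_bump_def abs_prod by (intro prod_le_1) (auto simp: flat_def abs_mult intro!: mult_le_one)

lemma box_bump_tendsto_indicator:
  "(\<lambda>n. box_bump (inverse (real (Suc n))) l r x) \<longlonglongrightarrow> indicator (box l r) x"
proof (cases "x \<in> box l r")
  case True
  have lim: "(\<lambda>n. flat (inverse (real (Suc n))) 1 y) \<longlonglongrightarrow> 1" if "y > 0" for y
  proof -
    have "(\<lambda>n. exp (- inverse (real (Suc n)) / y)) \<longlonglongrightarrow> exp (- 0 / y)"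
      using that by (intro tendsto_intros LIMSEQ_inverse_real_of_nat) auto
    then show ?thesis using that by (simp add: flat_def)
  qed
  have "(\<lambda>n. box_bump (inverse (real (Suc n))) l r x) \<longlonglongrightarrow> (\<Prod>b\<in>(Basis::'a set). 1 * 1)"
    unfolding box_bump_def using True by (intro tendsto_prod tendsto_mult lim) (auto simp: mem_box)
  then show ?thesis using True by simp
qed (simp add: box_bump_eq_0)

section \<open>The fundamental lemma of the calculus of variations\<close>

text \<open>
  The derivatives of a test function vanish off the same compact set, because its complement is
  open.
\<close>

lemma test_function_partial_deriv:
  assumes "\<phi> \<in> test_functions \<Omega>" "i \<in> Basis"
  obtains K where "compact K" "K \<subseteq> \<Omega>" "\<And>x. x \<notin> K \<Longrightarrow> \<phi> x = 0"
    "\<And>x. x \<notin> K \<Longrightarrow> partial_deriv i \<phi> x = 0"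
    "continuous_on UNIV \<phi>" "continuous_on UNIV (partial_deriv i \<phi>)"
proof -
  obtain K where K: "compact K" "K \<subseteq> \<Omega>" "\<And>x. x \<notin> K \<Longrightarrow> \<phi> x = 0" and "smooth \<phi>"
    using assms by (auto simp: test_functions_def)
  then have "Ck 0 \<phi>" "Ck (Suc 0) \<phi>"
    unfolding smooth_def by blast+
  moreover have "partial_deriv i \<phi> x = 0" if "x \<notin> K" for x
  proof -
    have "((\<lambda>x. 0 :: real) has_derivative (\<lambda>h. 0)) (at x)" by simp
    then have "(\<phi> has_derivative (\<lambda>h. 0)) (at x)"
      by (rule has_derivative_transform_within_open[where s="- K"])
        (use that K in \<open>auto simp: compact_imp_closed open_Compl\<close>)
    then show ?thesis by (rule partial_deriv_eq)
  qed
  ultimately show thesis using K assms(2) that[of K] by auto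
qed

lemma integrable_mult_compact_support:
  fixes u \<phi> :: "'a::euclidean_space \<Rightarrow> real"
  assumes \<Omega>: "\<Omega> \<in> sets lebesgue" and u: "locally_integrable \<Omega> u"
    and \<phi>: "continuous_on UNIV \<phi>" and K: "compact K" "K \<subseteq> \<Omega>" "\<And>x. x \<notin> K \<Longrightarrow> \<phi> x = 0"
  shows "integrable (lebesgue_on \<Omega>) (\<lambda>x. u x * \<phi> x)"
proof -
  have Km: "K \<in> sets lebesgue"
    using K(1) by (simp add: compact_imp_closed)
  have "(\<lambda>x. \<phi> x * u x) absolutely_integrable_on K"
  proof (rule absolutely_integrable_bounded_measurable_product[OF bilinear_times])
    show "\<phi> \<in> borel_measurable (lebesgue_on K)"
      using \<phi> Km continuous_imp_measurable_on_sets_lebesgue continuous_on_subset by blast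
    show "bounded (\<phi> ` K)"
      by (meson K(1) \<phi> compact_continuous_image compact_imp_bounded continuous_on_subset subset_UNIV)
    show "u absolutely_integrable_on K"
      using u K by (auto simp: locally_integrable_def)
  qed (rule Km)
  then have "integrable lebesgue (\<lambda>x. indicator K x *\<^sub>R (\<phi> x * u x))"
    by (simp add: set_integrable_def)
  moreover have "indicator K x *\<^sub>R (\<phi> x * u x) = indicator \<Omega> x *\<^sub>R (u x * \<phi> x)" for x
    using K by (cases "x \<in> K") (auto simp: indicator_def)
  ultimately have "integrable lebesgue (\<lambda>x. indicator \<Omega> x *\<^sub>R (u x * \<phi> x))"
    by (simp only:)
  then show ?thesis
    using \<Omega> by (simp add: integrable_restrict_space)
qed

lemma integrable_mult_test_function:
  assumes "open \<Omega>" "locally_integrable \<Omega> u" "\<phi> \<in> test_functions \<Omega>" "i \<in> Basis"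
  shows "integrable (lebesgue_on \<Omega>) (\<lambda>x. u x * \<phi> x)"
    and "integrable (lebesgue_on \<Omega>) (\<lambda>x. u x * partial_deriv i \<phi> x)"
proof -
  obtain K where "compact K" "K \<subseteq> \<Omega>" "\<And>x. x \<notin> K \<Longrightarrow> \<phi> x = 0"
    "\<And>x. x \<notin> K \<Longrightarrow> partial_deriv i \<phi> x = 0"
    "continuous_on UNIV \<phi>" "continuous_on UNIV (partial_deriv i \<phi>)"
    using test_function_partial_deriv[OF assms(3,4)] by metis
  then show "integrable (lebesgue_on \<Omega>) (\<lambda>x. u x * \<phi> x)"
    "integrable (lebesgue_on \<Omega>) (\<lambda>x. u x * partial_deriv i \<phi> x)"
    using integrable_mult_compact_support[OF _ assms(2), of _ K] assms(1) by auto
qed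

lemma locally_integrable_diff:
  assumes "locally_integrable \<Omega> u" "locally_integrable \<Omega> v"
  shows "locally_integrable \<Omega> (\<lambda>x. u x - v x)"
  using assms unfolding locally_integrable_def by (auto intro: set_integral_diff(1))

text \<open>
  The bumps \<^const>\<open>box_bump\<close> increase to the indicator of the open box while staying below \<open>1\<close>, and
  \<open>w\<close> is integrable on the closed box, so dominated convergence carries the vanishing of the test
  integrals over to the box.
\<close>

lemma integral_cbox_eq_0_if_test_integrals_eq_0:
  fixes w :: "'a::euclidean_space \<Rightarrow> real"
  assumes \<Omega>: "open \<Omega>" and w: "locally_integrable \<Omega> w"
    and test: "\<And>\<phi>. \<phi> \<in> test_functions \<Omega> \<Longrightarrow> (LINT x|lebesgue_on \<Omega>. w x * \<phi> x) = 0"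
    and sub: "cbox l r \<subseteq> \<Omega>"
  shows "integral (cbox l r) w = 0"
proof -
  define \<phi> where "\<phi> n = box_bump (inverse (real (Suc n))) l r" for n
  have \<phi>_test: "\<phi> n \<in> test_functions \<Omega>" for n
    unfolding \<phi>_def by (rule box_bump_test_function) (use sub in auto)
  have \<Omega>m: "\<Omega> \<in> sets lebesgue" using \<Omega> by simp
  have wK: "w absolutely_integrable_on cbox l r"
    using w sub by (simp add: locally_integrable_def)
  have wbox: "w absolutely_integrable_on box l r"
    by (rule set_integrable_subset[OF wK]) (auto simp: box_subset_cbox)
  have dom: "integrable (lebesgue_on \<Omega>) (\<lambda>x. indicator (cbox l r) x * \<bar>w x\<bar>)"
  proof -
    have "integrable lebesgue (\<lambda>x. \<bar>indicator (cbox l r) x *\<^sub>R w x\<bar>)"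
      using wK unfolding set_integrable_def by (rule integrable_abs)
    moreover have "\<bar>indicator (cbox l r) x *\<^sub>R w x\<bar> = indicator \<Omega> x *\<^sub>R (indicator (cbox l r) x * \<bar>w x\<bar>)" for x
      using sub by (auto simp: indicator_def)
    ultimately show ?thesis
      using \<Omega>m by (simp add: integrable_restrict_space)
  qed
  have "(\<lambda>n. LINT x|lebesgue_on \<Omega>. w x * \<phi> n x) \<longlonglongrightarrow> (LINT x|lebesgue_on \<Omega>. w x * indicator (box l r) x)"
  proof (rule integral_dominated_convergence[OF _ _ dom])
    have "indicator (box l r) \<in> borel_measurable (lebesgue_on \<Omega>)"
      by (intro measurable_restrict_space1 borel_measurable_indicator) auto
    with w show "(\<lambda>x. w x * indicator (box l r) x) \<in> borel_measurable (lebesgue_on \<Omega>)"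
      unfolding locally_integrable_def by (intro borel_measurable_times) simp_all
    show "(\<lambda>x. w x * \<phi> n x) \<in> borel_measurable (lebesgue_on \<Omega>)" for n
      using integrable_mult_test_function(1)[OF \<Omega> w \<phi>_test[of n] SOME_Basis] by auto
    show "AE x in lebesgue_on \<Omega>. (\<lambda>n. w x * \<phi> n x) \<longlonglongrightarrow> w x * indicator (box l r) x"
      unfolding \<phi>_def by (intro AE_I2 tendsto_mult_left box_bump_tendsto_indicator)
    show "AE x in lebesgue_on \<Omega>. norm (w x * \<phi> n x) \<le> indicator (cbox l r) x * \<bar>w x\<bar>" for n
    proof (rule AE_I2)
      fix x
      have "\<bar>\<phi> n x\<bar> \<le> 1" "x \<notin> cbox l r \<Longrightarrow> \<phi> n x = 0"
        using abs_box_bump_le_1[of "inverse (real (Suc n))" l r x] box_bump_eq_0[of x l r] box_subset_cbox[of l r]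
        by (auto simp: \<phi>_def)
      then show "norm (w x * \<phi> n x) \<le> indicator (cbox l r) x * \<bar>w x\<bar>"
        using mult_left_mono[of "\<bar>\<phi> n x\<bar>" 1 "\<bar>w x\<bar>"] by (auto simp: indicator_def abs_mult)
    qed
  qed
  then have "(LINT x|lebesgue_on \<Omega>. w x * indicator (box l r) x) = 0"
    using test[OF \<phi>_test] by (simp add: LIMSEQ_const_iff)
  also have "(LINT x|lebesgue_on \<Omega>. w x * indicator (box l r) x) =
      (LINT x|lebesgue. indicator (box l r) x *\<^sub>R w x)"
  proof -
    have "indicator \<Omega> x *\<^sub>R (w x * indicator (box l r) x) = indicator (box l r) x *\<^sub>R w x" for x
      using sub box_subset_cbox[of l r] by (auto simp: indicator_def)
    then have "(LINT x|lebesgue. indicator \<Omega> x *\<^sub>R (w x * indicator (box l r) x)) =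
        (LINT x|lebesgue. indicator (box l r) x *\<^sub>R w x)"
      by (simp only:)
    then show ?thesis using \<Omega>m by (simp add: integral_restrict_space)
  qed
  also have "\<dots> = integral (box l r) w"
    using set_lebesgue_integral_eq_integral(2)[OF wbox] by (simp add: set_lebesgue_integral_def)
  finally show ?thesis by (simp add: integral_open_interval)
qed

text \<open>
  By the Lebesgue differentiation theorem, \<open>w\<close> is almost everywhere the limit of its averages over
  shrinking cubes. Extending \<open>w\<close> by \<open>0\<close> gives a function on the whole space to which that theorem
  applies; near an interior point of the box the averages are those of \<open>w\<close>.
\<close>

lemma negligible_nonzero_if_integral_cbox_eq_0:
  fixes w :: "'a::euclidean_space \<Rightarrow> real"
  assumes w: "w absolutely_integrable_on cbox a b"
    and zero: "\<And>l r. cbox l r \<subseteq> cbox a b \<Longrightarrow> integral (cbox l r) w = 0"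
  shows "negligible {x \<in> cbox a b. w x \<noteq> 0}"
proof -
  define f where "f = (\<lambda>x. if x \<in> cbox a b then w x else 0)"
  have "f integrable_on UNIV"
    using set_lebesgue_integral_eq_integral(1)[OF w]
    by (simp add: f_def integrable_restrict_UNIV)
  then have "f integrable_on cbox l r" for l r
    by (rule integrable_on_subcbox) simp
  then obtain N where N: "negligible N"
    and avg: "\<And>x e. \<lbrakk>x \<notin> N; 0 < e\<rbrakk> \<Longrightarrow> \<exists>d>0. \<forall>h. 0 < h \<and> h < d \<longrightarrow>
        norm (integral (cbox x (x + h *\<^sub>R One)) f /\<^sub>R h ^ DIM('a) - f x) < e"
    using integrable_ccontinuous_explicit[of f] by metis
  have "w x = 0" if x: "x \<in> box a b" "x \<notin> N" for x
  proof (rule ccontr)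
    assume "w x \<noteq> 0"
    then obtain d where d: "d > 0" "\<And>h. 0 < h \<Longrightarrow> h < d \<Longrightarrow>
        norm (integral (cbox x (x + h *\<^sub>R One)) f /\<^sub>R h ^ DIM('a) - f x) < \<bar>w x\<bar>"
      using avg[OF x(2), of "\<bar>w x\<bar>"] by auto
    obtain e where e: "e > 0" "cball x e \<subseteq> box a b"
      using x(1) open_box open_contains_cball by blast
    \<comment> \<open>a cube of side \<open>h\<close> lies in the ball of radius \<open>DIM('a) * h\<close> about its corner\<close>
    define h where "h = min (d / 2) (e / DIM('a))"
    have h: "0 < h" "h < d" "DIM('a) * h \<le> e"
      using d e by (auto simp: h_def min_def field_simps)
    have sub: "cbox x (x + h *\<^sub>R One) \<subseteq> cball x e"
    proof
      fix y assume y: "y \<in> cbox x (x + h *\<^sub>R One)"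
      have "norm (y - x) \<le> (\<Sum>i\<in>Basis. \<bar>(y - x) \<bullet> i\<bar>)"
        by (rule norm_le_l1)
      also have "\<dots> \<le> (\<Sum>i\<in>(Basis::'a set). h)"
        using y by (intro sum_mono) (force simp: mem_box inner_diff_left inner_add_left)
      finally show "y \<in> cball x e"
        using h(3) by (simp add: dist_norm norm_minus_commute)
    qed
    then have sub': "cbox x (x + h *\<^sub>R One) \<subseteq> cbox a b"
      using e(2) box_subset_cbox by blast
    then have "integral (cbox x (x + h *\<^sub>R One)) f = integral (cbox x (x + h *\<^sub>R One)) w"
      by (intro Henstock_Kurzweil_Integration.integral_cong) (auto simp: f_def)
    then show False
      using d(2)[OF h(1,2)] zero[OF sub'] x(1) box_subset_cbox[of a b] by (auto simp: f_def)
  qed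
  then have "{x \<in> cbox a b. w x \<noteq> 0} \<subseteq> N \<union> (cbox a b - box a b)"
    by auto
  then show ?thesis
    using N negligible_frontier_interval negligible_Un negligible_subset by blast
qed

text \<open>
  An open set is a countable union of closed boxes, on each of which \<open>w\<close> is integrable and has
  vanishing integrals over all smaller boxes.
\<close>

lemma fundamental_lemma_calculus_of_variations:
  fixes w :: "'a::euclidean_space \<Rightarrow> real"
  assumes \<Omega>: "open \<Omega>" and w: "locally_integrable \<Omega> w"
    and test: "\<And>\<phi>. \<phi> \<in> test_functions \<Omega> \<Longrightarrow> (LINT x|lebesgue_on \<Omega>. w x * \<phi> x) = 0"
  shows "AE x in lebesgue_on \<Omega>. w x = 0"
proof -
  obtain \<D> where \<D>: "countable \<D>" "\<D> \<subseteq> Pow \<Omega>" "\<And>X. X \<in> \<D> \<Longrightarrow> \<exists>a b. X = cbox a b" "\<Union>\<D> = \<Omega>"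
    using open_countable_Union_open_cbox[OF \<Omega>] by blast
  have "negligible {x \<in> X. w x \<noteq> 0}" if XD: "X \<in> \<D>" for X
  proof -
    obtain a b where X: "X = cbox a b" "cbox a b \<subseteq> \<Omega>"
      using \<D>(2) \<D>(3)[OF XD] XD by auto
    have "w absolutely_integrable_on cbox a b"
      using w X by (simp add: locally_integrable_def)
    then show ?thesis
      unfolding X(1) using X(2) integral_cbox_eq_0_if_test_integrals_eq_0[OF \<Omega> w test]
      by (intro negligible_nonzero_if_integral_cbox_eq_0) auto
  qed
  then have "negligible (\<Union>X\<in>\<D>. {x \<in> X. w x \<noteq> 0})"
    using \<D>(1) by (intro negligible_countable_Union) auto
  moreover have "(\<Union>X\<in>\<D>. {x \<in> X. w x \<noteq> 0}) = {x \<in> \<Omega>. w x \<noteq> 0}"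
    using \<D>(4) by auto
  ultimately have "AE x in lebesgue. x \<in> \<Omega> \<longrightarrow> w x = 0"
    by (intro AE_I'[of "{x \<in> \<Omega>. w x \<noteq> 0}"]) (auto simp: negligible_iff_null_sets)
  then show ?thesis
    using \<Omega> by (simp add: AE_restrict_space_iff)
qed

section \<open>Weak derivatives: uniqueness, differences and translations\<close>

text \<open>
  This makes \<^const>\<open>weak_pderiv\<close>, an arbitrary choice among the weak derivatives, usable: almost
  everywhere it agrees with any weak derivative that can be written down. The difference of two weak
  derivatives is orthogonal to all test functions.
\<close>

lemma has_weak_pderiv_unique:
  fixes u :: "'a::euclidean_space \<Rightarrow> real"
  assumes \<Omega>: "open \<Omega>" and v: "has_weak_pderiv \<Omega> i u v" and v': "has_weak_pderiv \<Omega> i u v'"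
  shows "AE x in lebesgue_on \<Omega>. v x = v' x"
proof -
  have loc: "locally_integrable \<Omega> v" "locally_integrable \<Omega> v'"
    using v v' by (auto simp: has_weak_pderiv_def)
  have "AE x in lebesgue_on \<Omega>. v x - v' x = 0"
  proof (rule fundamental_lemma_calculus_of_variations[OF \<Omega> locally_integrable_diff[OF loc]])
    fix \<phi> :: "'a \<Rightarrow> real" assume \<phi>: "\<phi> \<in> test_functions \<Omega>"
    note [simp] = integrable_mult_test_function(1)[OF \<Omega> loc(1) \<phi> SOME_Basis]
      integrable_mult_test_function(1)[OF \<Omega> loc(2) \<phi> SOME_Basis]
    show "(LINT x|lebesgue_on \<Omega>. (v x - v' x) * \<phi> x) = 0"
      using v v' \<phi> by (simp add: left_diff_distrib has_weak_pderiv_def)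
  qed
  then show ?thesis by simp
qed

lemma has_weak_pderiv_diff:
  assumes \<Omega>: "open \<Omega>" and i: "i \<in> Basis"
    and v: "has_weak_pderiv \<Omega> i u v" and v': "has_weak_pderiv \<Omega> i u' v'"
  shows "has_weak_pderiv \<Omega> i (\<lambda>x. u x - u' x) (\<lambda>x. v x - v' x)"
proof -
  have loc: "locally_integrable \<Omega> v" "locally_integrable \<Omega> v'" "locally_integrable \<Omega> u" "locally_integrable \<Omega> u'"
    using v v' by (auto simp: has_weak_pderiv_def)
  have "(LINT x|lebesgue_on \<Omega>. (u x - u' x) * partial_deriv i \<phi> x) =
      - (LINT x|lebesgue_on \<Omega>. (v x - v' x) * \<phi> x)" if \<phi>: "\<phi> \<in> test_functions \<Omega>" for \<phi>
  proof -
    note [simp] = loc[THEN integrable_mult_test_function(1)[OF \<Omega> _ \<phi> i]]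
      loc[THEN integrable_mult_test_function(2)[OF \<Omega> _ \<phi> i]]
    show ?thesis using v v' \<phi> by (simp add: left_diff_distrib has_weak_pderiv_def)
  qed
  then show ?thesis
    using loc locally_integrable_diff by (auto simp: has_weak_pderiv_def)
qed

text \<open>
  Translations are the case of unit scaling factors in the affine change of variables.
\<close>

lemma lebesgue_distr_translation:
  shows "distr lebesgue lebesgue ((+) (c::'a::euclidean_space)) = lebesgue"
    and "(+) c \<in> lebesgue \<rightarrow>\<^sub>M lebesgue"
proof -
  have "(\<lambda>x. c + (\<Sum>j\<in>Basis. (1 * (x \<bullet> j)) *\<^sub>R j)) = (+) c"
    by (simp add: euclidean_representation fun_eq_iff)
  then show "distr lebesgue lebesgue ((+) c) = lebesgue" "(+) c \<in> lebesgue \<rightarrow>\<^sub>M lebesgue"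
    using lebesgue_affine_euclidean[of "\<lambda>_. 1" c] lebesgue_affine_measurable[of "\<lambda>_. 1" c]
    by (simp_all add: density_1)
qed

lemma translation_measurable_lebesgue_on:
  fixes c :: "'a::euclidean_space"
  assumes "(+) c ` \<Omega> \<subseteq> \<Omega>'"
  shows "(+) c \<in> lebesgue_on \<Omega> \<rightarrow>\<^sub>M lebesgue_on \<Omega>'"
  using assms by (intro measurable_restrict_space2 measurable_restrict_space1 lebesgue_distr_translation)
    (auto simp: space_restrict_space)

lemma integrable_lebesgue_on_translation:
  fixes f :: "'a::euclidean_space \<Rightarrow> real"
  assumes meas: "\<Omega> \<in> sets lebesgue" "\<Omega>' \<in> sets lebesgue" and sub: "(+) c ` \<Omega> \<subseteq> \<Omega>'"
    and f: "integrable (lebesgue_on \<Omega>') f"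
  shows "integrable (lebesgue_on \<Omega>) (\<lambda>x. f (c + x))"
proof -
  have "integrable (distr lebesgue lebesgue ((+) c)) (\<lambda>x. indicator \<Omega>' x *\<^sub>R f x)"
    using f meas by (simp add: lebesgue_distr_translation(1) integrable_restrict_space)
  then have "integrable lebesgue (\<lambda>x. indicator \<Omega>' (c + x) *\<^sub>R f (c + x))"
    by (rule integrable_distr[OF lebesgue_distr_translation(2)])
  then have "integrable lebesgue (\<lambda>x. indicator \<Omega> x *\<^sub>R (indicator \<Omega>' (c + x) *\<^sub>R f (c + x)))"
    using meas(1) by (rule integrable_mult_indicator[rotated])
  moreover have "indicator \<Omega> x *\<^sub>R (indicator \<Omega>' (c + x) *\<^sub>R f (c + x)) = indicator \<Omega> x *\<^sub>R f (c + x)" for x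
    using sub by (auto simp: indicator_def)
  ultimately have "integrable lebesgue (\<lambda>x. indicator \<Omega> x *\<^sub>R f (c + x))"
    by (simp only:)
  then show ?thesis
    using meas by (simp add: integrable_restrict_space)
qed

text \<open>
  The support condition makes up for the part of the larger set that the translate of the smaller
  one does not reach.
\<close>

lemma integral_lebesgue_on_translation:
  fixes f :: "'a::euclidean_space \<Rightarrow> real"
  assumes meas: "\<Omega> \<in> sets lebesgue" "\<Omega>' \<in> sets lebesgue" and sub: "(+) c ` \<Omega> \<subseteq> \<Omega>'"
    and f: "integrable (lebesgue_on \<Omega>') f" and supp: "\<And>x. x \<notin> \<Omega> \<Longrightarrow> f (c + x) = 0"
  shows "(LINT x|lebesgue_on \<Omega>'. f x) = (LINT x|lebesgue_on \<Omega>. f (c + x))"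
proof -
  have "(LINT x|lebesgue_on \<Omega>'. f x) = (LINT x|distr lebesgue lebesgue ((+) c). indicator \<Omega>' x *\<^sub>R f x)"
    using meas by (simp add: lebesgue_distr_translation(1) integral_restrict_space)
  also have "\<dots> = (LINT x|lebesgue. indicator \<Omega>' (c + x) *\<^sub>R f (c + x))"
    using f meas
    by (intro integral_distr lebesgue_distr_translation(2) borel_measurable_integrable)
      (simp add: integrable_restrict_space)
  also have "\<dots> = (LINT x|lebesgue. indicator \<Omega> x *\<^sub>R f (c + x))"
    using sub supp by (intro Bochner_Integration.integral_cong) (auto simp: indicator_def)
  finally show ?thesis
    using meas by (simp add: integral_restrict_space)
qed

lemma locally_integrable_translation:
  fixes u :: "'a::euclidean_space \<Rightarrow> real"
  assumes u: "locally_integrable \<Omega>' u" and sub: "(+) c ` \<Omega> \<subseteq> \<Omega>'"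
  shows "locally_integrable \<Omega> (\<lambda>x. u (c + x))"
  unfolding locally_integrable_def
proof (intro conjI allI impI)
  show "(\<lambda>x. u (c + x)) \<in> borel_measurable (lebesgue_on \<Omega>)"
    using u measurable_compose[OF translation_measurable_lebesgue_on[OF sub]]
    by (auto simp: locally_integrable_def)
  fix K assume K: "compact K \<and> K \<subseteq> \<Omega>"
  then have cK: "compact ((+) c ` K)" "(+) c ` K \<subseteq> \<Omega>'"
    using sub compact_translation by (auto simp: image_subset_iff)
  then have "integrable (lebesgue_on ((+) c ` K)) u"
    using u by (simp add: locally_integrable_def set_integrable_def integrable_restrict_space compact_imp_closed)
  then have "integrable (lebesgue_on K) (\<lambda>x. u (c + x))"
    using K cK by (intro integrable_lebesgue_on_translation[of _ "(+) c ` K"]) (auto simp: compact_imp_closed)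
  then show "(\<lambda>x. u (c + x)) absolutely_integrable_on K"
    using K by (simp add: set_integrable_def integrable_restrict_space compact_imp_closed)
qed

lemma test_functions_translation:
  assumes "\<phi> \<in> test_functions \<Omega>" "(+) c ` \<Omega> \<subseteq> \<Omega>'"
  shows "(\<lambda>x. \<phi> (- c + x)) \<in> test_functions \<Omega>'"
proof -
  obtain K where K: "compact K" "K \<subseteq> \<Omega>" "\<And>x. x \<notin> K \<Longrightarrow> \<phi> x = 0" and "smooth \<phi>"
    using assms by (auto simp: test_functions_def)
  have "smooth (\<lambda>x. \<phi> (- c + x))"
    using \<open>smooth \<phi>\<close> unfolding smooth_def by (intro allI Ck_translate) blast
  moreover have "\<phi> (- c + x) = 0" if "x \<notin> (+) c ` K" for x
    using that by (intro K) force
  moreover have "(+) c ` K \<subseteq> \<Omega>'"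
    using K(2) assms(2) by blast
  ultimately show ?thesis
    using compact_translation[OF K(1), of c] unfolding test_functions_def by blast
qed

text \<open>
  A test function on the smaller set becomes one on the larger set after translation by \<open>c\<close>, and
  the identity for it is transported back by the change of variables. The case \<open>c = 0\<close> is
  restriction to an open subset.
\<close>

lemma has_weak_pderiv_translation:
  fixes u :: "'a::euclidean_space \<Rightarrow> real"
  assumes op: "open \<Omega>" "open \<Omega>'" and i: "i \<in> Basis" and sub: "(+) c ` \<Omega> \<subseteq> \<Omega>'"
    and v: "has_weak_pderiv \<Omega>' i u v"
  shows "has_weak_pderiv \<Omega> i (\<lambda>x. u (c + x)) (\<lambda>x. v (c + x))"
proof -
  have loc: "locally_integrable \<Omega>' u" "locally_integrable \<Omega>' v"
    using v by (auto simp: has_weak_pderiv_def)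
  have "(LINT x|lebesgue_on \<Omega>. u (c + x) * partial_deriv i \<phi> x) =
      - (LINT x|lebesgue_on \<Omega>. v (c + x) * \<phi> x)" if \<phi>: "\<phi> \<in> test_functions \<Omega>" for \<phi>
  proof -
    define \<psi> where "\<psi> = (\<lambda>x. \<phi> (- c + x))"
    have \<psi>: "\<psi> \<in> test_functions \<Omega>'"
      unfolding \<psi>_def by (rule test_functions_translation[OF \<phi> sub])
    have "Ck (Suc 0) \<phi>"
      using \<phi> unfolding test_functions_def smooth_def by blast
    then have "\<phi> differentiable (at y)" for y
      by simp
    then have \<psi>': "partial_deriv i \<psi> (c + x) = partial_deriv i \<phi> x" for x
      using partial_deriv_eq[OF has_derivative_translate[of \<phi> "- c" "c + x"], of i]
      by (simp add: \<psi>_def partial_deriv_def)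
    have \<psi>_shift: "\<psi> (c + x) = \<phi> x" for x
      by (simp add: \<psi>_def)
    obtain K where K: "K \<subseteq> \<Omega>" "\<And>x. x \<notin> K \<Longrightarrow> \<phi> x = 0" "\<And>x. x \<notin> K \<Longrightarrow> partial_deriv i \<phi> x = 0"
      using test_function_partial_deriv[OF \<phi> i] by metis
    have "(LINT x|lebesgue_on \<Omega>'. u x * partial_deriv i \<psi> x) =
        (LINT x|lebesgue_on \<Omega>. u (c + x) * partial_deriv i \<phi> x)"
      using integral_lebesgue_on_translation[OF _ _ sub integrable_mult_test_function(2)[OF op(2) loc(1) \<psi> i]] op K
      unfolding \<psi>' by auto
    moreover have "(LINT x|lebesgue_on \<Omega>'. v x * \<psi> x) = (LINT x|lebesgue_on \<Omega>. v (c + x) * \<phi> x)"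
      using integral_lebesgue_on_translation[OF _ _ sub integrable_mult_test_function(1)[OF op(2) loc(2) \<psi> i]] op K
      unfolding \<psi>_shift by auto
    ultimately show ?thesis
      using v \<psi> by (simp add: has_weak_pderiv_def)
  qed
  then show ?thesis
    using loc locally_integrable_translation[OF _ sub] by (auto simp: has_weak_pderiv_def)
qed

section \<open>Square-integrable functions and the difference operator\<close>

lemma L2_mult_integrable:
  assumes "f \<in> L2 M" "g \<in> L2 M"
  shows "integrable M (\<lambda>x. f x * g x)"
proof (rule Bochner_Integration.integrable_bound)
  show "integrable M (\<lambda>x. (f x)\<^sup>2 + (g x)\<^sup>2)"
    using assms by (auto simp: L2_def)
  show "(\<lambda>x. f x * g x) \<in> borel_measurable M"
    using assms by (auto simp: L2_def)
  have "\<bar>f x * g x\<bar> \<le> (f x)\<^sup>2 + (g x)\<^sup>2" for x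
  proof -
    have "2 * (\<bar>f x\<bar> * \<bar>g x\<bar>) \<le> (f x)\<^sup>2 + (g x)\<^sup>2"
      using sum_squares_bound[of "\<bar>f x\<bar>" "\<bar>g x\<bar>"] by (simp add: mult.assoc)
    moreover have "0 \<le> \<bar>f x\<bar> * \<bar>g x\<bar>"
      by simp
    ultimately show ?thesis
      unfolding abs_mult by linarith
  qed
  then show "AE x in M. norm (f x * g x) \<le> norm ((f x)\<^sup>2 + (g x)\<^sup>2)"
    by (intro AE_I2) auto
qed

lemma L2_diff:
  assumes "f \<in> L2 M" "g \<in> L2 M"
  shows "(\<lambda>x. f x - g x) \<in> L2 M"
  using assms L2_mult_integrable[OF assms] borel_measurable_diff[of f M g]
  by (simp add: L2_def power2_diff mult.assoc)

lemma L2_cong_AE: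
  assumes "f \<in> L2 M" "g \<in> borel_measurable M" "AE x in M. f x = g x"
  shows "g \<in> L2 M"
proof -
  have "integrable M (\<lambda>x. (g x)\<^sup>2) \<longleftrightarrow> integrable M (\<lambda>x. (f x)\<^sup>2)"
  proof (rule integrable_cong_AE)
    show "AE x in M. (g x)\<^sup>2 = (f x)\<^sup>2"
      using assms(3) by eventually_elim simp
    show "(\<lambda>x. (g x)\<^sup>2) \<in> borel_measurable M" "(\<lambda>x. (f x)\<^sup>2) \<in> borel_measurable M"
      using assms(1,2) by (simp_all add: L2_def borel_measurable_integrable)
  qed
  then show ?thesis using assms by (simp add: L2_def)
qed

lemma L2_translation:
  fixes f :: "'a::euclidean_space \<Rightarrow> real"
  assumes "open \<Omega>" "open \<Omega>'" "(+) c ` \<Omega> \<subseteq> \<Omega>'" "f \<in> L2 (lebesgue_on \<Omega>')"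
  shows "(\<lambda>x. f (c + x)) \<in> L2 (lebesgue_on \<Omega>)"
proof -
  have "(\<lambda>x. f (c + x)) \<in> borel_measurable (lebesgue_on \<Omega>)"
    using assms(4) by (intro measurable_compose[OF translation_measurable_lebesgue_on[OF assms(3)]])
      (simp add: L2_def)
  moreover have "integrable (lebesgue_on \<Omega>) (\<lambda>x. (f (c + x))\<^sup>2)"
    using assms by (intro integrable_lebesgue_on_translation[of \<Omega> \<Omega>' c "\<lambda>x. (f x)\<^sup>2"])
      (simp_all add: L2_def)
  ultimately show ?thesis
    by (simp add: L2_def)
qed

text \<open>
  The chosen representative is square integrable because it agrees almost everywhere with a weak
  derivative that is.
\<close>

lemma W12_weak_pderiv:
  assumes \<Omega>: "open \<Omega>" and u: "u \<in> W12 \<Omega>" and i: "i \<in> Basis"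
  shows has_weak_pderiv_weak_pderiv: "has_weak_pderiv \<Omega> i u (weak_pderiv \<Omega> i u)"
    and weak_pderiv_L2: "weak_pderiv \<Omega> i u \<in> L2 (lebesgue_on \<Omega>)"
proof -
  obtain v where v: "v \<in> L2 (lebesgue_on \<Omega>)" "has_weak_pderiv \<Omega> i u v"
    using u i by (auto simp: W12_def)
  show wp: "has_weak_pderiv \<Omega> i u (weak_pderiv \<Omega> i u)"
    unfolding weak_pderiv_def by (rule someI[of "has_weak_pderiv \<Omega> i u", OF v(2)])
  show "weak_pderiv \<Omega> i u \<in> L2 (lebesgue_on \<Omega>)"
    using wp has_weak_pderiv_unique[OF \<Omega> v(2) wp]
    by (intro L2_cong_AE[OF v(1)]) (simp_all add: has_weak_pderiv_def locally_integrable_def)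
qed

lemma weak_pderiv_AE_eq:
  assumes \<Omega>: "open \<Omega>" and v: "has_weak_pderiv \<Omega> i u v"
  shows "AE x in lebesgue_on \<Omega>. weak_pderiv \<Omega> i u x = v x"
  using has_weak_pderiv_unique[OF \<Omega> _ v] someI[of "has_weak_pderiv \<Omega> i u", OF v]
  by (simp add: weak_pderiv_def)

lemma shift_diff_eq: "shift_diff v = (\<lambda>X. v ((0, 1) + X) - v X)" for v :: "'b::euclidean_space \<times> real \<Rightarrow> real"
  by (simp add: shift_diff_def fun_eq_iff add.commute)

text \<open>
  Differentiation commutes with \<^const>\<open>shift_diff\<close>, as it does with translations and with restriction
  from \<open>\<Omega>1\<close> to \<open>\<Omega>\<close>.
\<close>

lemma shift_diff_weak_pderiv:
  fixes u :: "'b::euclidean_space \<times> real \<Rightarrow> real"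
  assumes op: "open \<Omega>" "open \<Omega>1" and sub: "\<Omega> \<subseteq> \<Omega>1" "(+) (0, 1) ` \<Omega> \<subseteq> \<Omega>1"
    and u: "u \<in> W12 \<Omega>1"  and i: "i \<in> Basis"
  shows "has_weak_pderiv \<Omega> i u (weak_pderiv \<Omega>1 i u)"
    and "weak_pderiv \<Omega>1 i u \<in> L2 (lebesgue_on \<Omega>)"
    and "has_weak_pderiv \<Omega> i (shift_diff u) (shift_diff (weak_pderiv \<Omega>1 i u))"
    and "shift_diff (weak_pderiv \<Omega>1 i u) \<in> L2 (lebesgue_on \<Omega>)"
proof -
  have sub0: "(+) 0 ` \<Omega> \<subseteq> \<Omega>1"
    using sub(1) by simp
  note wp = W12_weak_pderiv[OF op(2) u i]
  show res: "has_weak_pderiv \<Omega> i u (weak_pderiv \<Omega>1 i u)"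
    using has_weak_pderiv_translation[OF op i sub0 wp(1)] by simp
  show resL2: "weak_pderiv \<Omega>1 i u \<in> L2 (lebesgue_on \<Omega>)"
    using L2_translation[OF op sub0 wp(2)] by simp
  show "has_weak_pderiv \<Omega> i (shift_diff u) (shift_diff (weak_pderiv \<Omega>1 i u))"
    unfolding shift_diff_eq
    by (rule has_weak_pderiv_diff[OF op(1) i has_weak_pderiv_translation[OF op i sub(2) wp(1)] res])
  show "shift_diff (weak_pderiv \<Omega>1 i u) \<in> L2 (lebesgue_on \<Omega>)"
    unfolding shift_diff_eq by (rule L2_diff[OF L2_translation[OF op sub(2) wp(2)] resL2])
qed

lemma shift_diff_W12:
  fixes u :: "'b::euclidean_space \<times> real \<Rightarrow> real"
  assumes op: "open \<Omega>" "open \<Omega>1" and sub: "\<Omega> \<subseteq> \<Omega>1" "(+) (0, 1) ` \<Omega> \<subseteq> \<Omega>1"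
    and u: "u \<in> W12 \<Omega>1"
  shows "shift_diff u \<in> W12 \<Omega>"
proof -
  have "u \<in> L2 (lebesgue_on \<Omega>1)" "(+) 0 ` \<Omega> \<subseteq> \<Omega>1"
    using u sub by (simp_all add: W12_def)
  then have "shift_diff u \<in> L2 (lebesgue_on \<Omega>)"
    unfolding shift_diff_eq
    using L2_diff[OF L2_translation[OF op sub(2)] L2_translation[OF op, of 0]] by simp
  then show ?thesis
    using shift_diff_weak_pderiv(3,4)[OF assms] unfolding W12_def by blast
qed

section \<open>The quadratic form of the coefficients\<close>

text \<open>
  Polarisation: for the symmetric form \<open>B\<close> with matrix \<open>A\<close>, four times an entry is
  \<open>B(i + j, i + j) - B(i - j, i - j)\<close>. Both terms lie in \<open>[0, 4C]\<close>, since \<open>i + j\<close> and \<open>i - j\<close> have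
  norm at most \<open>2\<close>.
\<close>

lemma bounded_coefficients:
  fixes A :: "'a::euclidean_space \<Rightarrow> 'a \<Rightarrow> real"
  assumes sym: "\<And>i j. i \<in> Basis \<Longrightarrow> j \<in> Basis \<Longrightarrow> A i j = A j i"
    and lower: "\<And>\<xi>. 0 \<le> (\<Sum>i\<in>Basis. \<Sum>j\<in>Basis. A i j * (\<xi> \<bullet> i) * (\<xi> \<bullet> j))"
    and upper: "\<And>\<xi>. (\<Sum>i\<in>Basis. \<Sum>j\<in>Basis. A i j * (\<xi> \<bullet> i) * (\<xi> \<bullet> j)) \<le> C * (norm \<xi>)\<^sup>2"
    and i: "i \<in> Basis" and j: "j \<in> Basis"
  shows "\<bar>A i j\<bar> \<le> C"
proof -
  define B where "B \<xi> \<eta> = (\<Sum>k\<in>Basis. \<Sum>l\<in>Basis. A k l * (\<xi> \<bullet> k) * (\<eta> \<bullet> l))" for \<xi> \<eta>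
  have B_basis: "B k l = A k l" if "k \<in> Basis" "l \<in> Basis" for k l
  proof -
    have "B k l = (\<Sum>k'\<in>Basis. if k = k' then A k' l else 0)"
      unfolding B_def
    proof (intro sum.cong refl)
      fix k' :: 'a assume "k' \<in> Basis"
      then have "(\<Sum>l'\<in>Basis. A k' l' * (k \<bullet> k') * (l \<bullet> l')) =
          (\<Sum>l'\<in>Basis. if l = l' then A k' l' * (if k = k' then 1 else 0) else 0)"
        using that by (intro sum.cong refl) (simp add: inner_Basis)
      then show "(\<Sum>l'\<in>Basis. A k' l' * (k \<bullet> k') * (l \<bullet> l')) = (if k = k' then A k' l else 0)"
        using that(2) by simp
    qed
    then show ?thesis using that(1) by simp
  qed
  have add: "B (\<xi> + \<xi>') \<eta> = B \<xi> \<eta> + B \<xi>' \<eta>" "B \<xi> (\<eta> + \<eta>') = B \<xi> \<eta> + B \<xi> \<eta>'"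
      "B (\<xi> - \<xi>') \<eta> = B \<xi> \<eta> - B \<xi>' \<eta>" "B \<xi> (\<eta> - \<eta>') = B \<xi> \<eta> - B \<xi> \<eta>'" for \<xi> \<xi>' \<eta> \<eta>'
    by (simp_all add: B_def inner_add_left inner_diff_left ring_distribs sum.distrib sum_subtractf)
  have polar: "4 * A i j = B (i + j) (i + j) - B (i - j) (i - j)"
    unfolding add using sym[OF i j] i j by (simp add: B_basis)
  have "0 \<le> C * (norm i)\<^sup>2"
    using lower[of i] upper[of i] by linarith
  then have C: "0 \<le> C"
    using i by simp
  have "0 \<le> B \<xi> \<xi> \<and> B \<xi> \<xi> \<le> 4 * C" if "norm \<xi> \<le> 2" for \<xi>
  proof -
    have "(norm \<xi>)\<^sup>2 \<le> 2\<^sup>2"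
      using that by (intro power_mono) auto
    then have "C * (norm \<xi>)\<^sup>2 \<le> C * 4"
      using C by (intro mult_left_mono) auto
    then show ?thesis
      using lower[of \<xi>] upper[of \<xi>] by (simp add: B_def)
  qed
  moreover have "norm (i + j) \<le> 2" "norm (i - j) \<le> 2"
    using norm_triangle_ineq[of i j] norm_triangle_ineq4[of i j] i j by simp_all
  ultimately have "0 \<le> B (i + j) (i + j) \<and> B (i + j) (i + j) \<le> 4 * C"
    "0 \<le> B (i - j) (i - j) \<and> B (i - j) (i - j) \<le> 4 * C"
    by blast+
  then show ?thesis using polar by linarith
qed

text \<open>
  By the discrete product rule \<open>Q(vw) = Qv Qw + w Qv + v Qw\<close>, only the two mixed terms are left in
  the difference, and the symmetry of \<open>A\<close> makes their sums equal.
\<close>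

lemma shift_diff_quadratic_form:
  fixes A :: "'a \<Rightarrow> 'a \<Rightarrow> real" and w :: "'a \<Rightarrow> 'b \<times> real \<Rightarrow> real"
  assumes sym: "\<And>i j. i \<in> I \<Longrightarrow> j \<in> I \<Longrightarrow> A i j = A j i"
  shows "(\<Sum>i\<in>I. \<Sum>j\<in>I. A i j * shift_diff (w i) X * shift_diff (w j) X)
      - (\<Sum>i\<in>I. \<Sum>j\<in>I. A i j * shift_diff (\<lambda>Y. w i Y * w j Y) X)
    = - 2 * (\<Sum>i\<in>I. \<Sum>j\<in>I. A i j * w j X * shift_diff (w i) X)"
proof -
  have prod_rule: "A i j * shift_diff (w i) X * shift_diff (w j) X
      - A i j * shift_diff (\<lambda>Y. w i Y * w j Y) X
      = - (A i j * w j X * shift_diff (w i) X + A i j * w i X * shift_diff (w j) X)" for i j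
    by (cases X) (simp add: shift_diff_def algebra_simps)
  have swap: "(\<Sum>i\<in>I. \<Sum>j\<in>I. A i j * w i X * shift_diff (w j) X)
      = (\<Sum>i\<in>I. \<Sum>j\<in>I. A i j * w j X * shift_diff (w i) X)"
    by (subst sum.swap) (intro sum.cong refl, simp add: sym)
  have "(\<Sum>i\<in>I. \<Sum>j\<in>I. A i j * shift_diff (w i) X * shift_diff (w j) X)
      - (\<Sum>i\<in>I. \<Sum>j\<in>I. A i j * shift_diff (\<lambda>Y. w i Y * w j Y) X)
    = - (\<Sum>i\<in>I. \<Sum>j\<in>I. A i j * w j X * shift_diff (w i) X + A i j * w i X * shift_diff (w j) X)"
    by (simp only: sum_subtractf[symmetric] prod_rule sum_negf)
  also have "\<dots> = - 2 * (\<Sum>i\<in>I. \<Sum>j\<in>I. A i j * w j X * shift_diff (w i) X)"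
    unfolding sum.distrib swap by simp
  finally show ?thesis .
qed

lemma integrable_bounded_mult:
  fixes b f :: "'a \<Rightarrow> real"
  assumes "b \<in> borel_measurable M" "\<And>x. \<bar>b x\<bar> \<le> C" "integrable M f"
  shows "integrable M (\<lambda>x. b x * f x)"
proof (rule Bochner_Integration.integrable_bound)
  show "integrable M (\<lambda>x. C * f x)"
    using assms(3) by simp
  show "(\<lambda>x. b x * f x) \<in> borel_measurable M"
    using assms by simp
  show "AE x in M. norm (b x * f x) \<le> norm (C * f x)"
  proof (rule AE_I2)
    fix x
    have "\<bar>b x\<bar> \<le> \<bar>C\<bar>"
      using assms(2)[of x] by linarith
    then show "norm (b x * f x) \<le> norm (C * f x)"
      by (simp add: abs_mult mult_right_mono)
  qed
qed

section \<open>The integral identity\<close>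

theorem lemma3p1:
  fixes a :: "(real^'d) \<times> real \<Rightarrow> (real^'d) \<times> real \<Rightarrow> (real^'d) \<times> real \<Rightarrow> real"
    and \<mu> :: real
    and \<Omega> \<Omega>1 :: "((real^'d) \<times> real) set"
    and u g :: "(real^'d) \<times> real \<Rightarrow> real"
  assumes dim: "CARD('d) \<ge> 2"
    and coeff_measurable: "\<And>i j. i \<in> Basis \<Longrightarrow> j \<in> Basis \<Longrightarrow> a i j \<in> borel_measurable lebesgue"
    and symmetric: "\<And>i j X. i \<in> Basis \<Longrightarrow> j \<in> Basis \<Longrightarrow> a i j X = a j i X"
    and mu_pos: "\<mu> > 0"
    and elliptic_lower: "\<And>X \<xi>. \<mu> * (norm \<xi>)\<^sup>2 \<le> (\<Sum>i\<in>Basis. \<Sum>j\<in>Basis. a i j X * (\<xi> \<bullet> i) * (\<xi> \<bullet> j))"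
    and elliptic_upper: "\<And>X \<xi>. (\<Sum>i\<in>Basis. \<Sum>j\<in>Basis. a i j X * (\<xi> \<bullet> i) * (\<xi> \<bullet> j)) \<le> inverse \<mu> * (norm \<xi>)\<^sup>2"
    and domain: "bounded_Lipschitz_domain \<Omega>"
    and g: "g \<in> L2 (surface_measure \<Omega>)"
    and solution: "variational_solution a \<Omega> g u"
    and open_\<Omega>1: "open \<Omega>1"
    and \<Omega>_sub: "\<Omega> \<subseteq> \<Omega>1"
    and \<Omega>_shift_sub: "{(x, t + 1) | x t. (x, t) \<in> \<Omega>} \<subseteq> \<Omega>1"
    and u_W12: "u \<in> W12 \<Omega>1"
  shows "- (LINT X|lebesgue_on \<Omega>. (\<Sum>i\<in>Basis. \<Sum>j\<in>Basis.
             a i j X * shift_diff (\<lambda>Y. weak_pderiv \<Omega>1 i u Y * weak_pderiv \<Omega>1 j u Y) X))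
         + (LINT X|lebesgue_on \<Omega>. (\<Sum>i\<in>Basis. \<Sum>j\<in>Basis.
             a i j X * shift_diff (weak_pderiv \<Omega>1 i u) X * shift_diff (weak_pderiv \<Omega>1 j u) X))
         = - 2 * (LINT X|surface_measure \<Omega>. g X * boundary_trace \<Omega> (shift_diff u) X)"
proof -
  let ?M = "lebesgue_on \<Omega>"
  define w where "w i = weak_pderiv \<Omega>1 i u" for i
  define F where "F X = (\<Sum>i\<in>Basis. \<Sum>j\<in>Basis. a i j X * shift_diff (\<lambda>Y. w i Y * w j Y) X)" for X
  define G where "G X = (\<Sum>i\<in>Basis. \<Sum>j\<in>Basis. a i j X * shift_diff (w i) X * shift_diff (w j) X)" for X
  define H where "H X = (\<Sum>i\<in>Basis. \<Sum>j\<in>Basis. a i j X * w j X * shift_diff (w i) X)" for X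

  have op: "open \<Omega>"
    using domain by (simp add: bounded_Lipschitz_domain_def)
  have shift_sub: "(+) (0, 1) ` \<Omega> \<subseteq> \<Omega>1"
    using \<Omega>_shift_sub by (force simp: add.commute)
  note wp = shift_diff_weak_pderiv[OF op open_\<Omega>1 \<Omega>_sub shift_sub u_W12, folded w_def]

  have a_meas: "a i j \<in> borel_measurable ?M" if "i \<in> Basis" "j \<in> Basis" for i j
    using coeff_measurable[OF that] by (rule measurable_restrict_space1)
  have a_bdd: "\<bar>a i j X\<bar> \<le> inverse \<mu>" if "i \<in> Basis" "j \<in> Basis" for i j X
  proof (rule bounded_coefficients[where A = "\<lambda>i j. a i j X"])
    show "0 \<le> (\<Sum>i\<in>Basis. \<Sum>j\<in>Basis. a i j X * (\<xi> \<bullet> i) * (\<xi> \<bullet> j))" for \<xi>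
      using elliptic_lower[of \<xi> X] mu_pos
      by (meson mult_nonneg_nonneg order.strict_implies_order order_trans zero_le_power2)
  qed (use that symmetric elliptic_upper in auto)
  have int: "integrable ?M (\<lambda>X. a i j X * (p X * q X))"
    if "i \<in> Basis" "j \<in> Basis" "p \<in> L2 ?M" "q \<in> L2 ?M" for i j p q
    using that by (intro integrable_bounded_mult[OF a_meas a_bdd] L2_mult_integrable)

  have int_G: "integrable ?M G" and int_H: "integrable ?M H"
    unfolding G_def H_def using int wp by (auto simp: mult.assoc)
  have GF: "G X - F X = - 2 * H X" for X
    unfolding G_def F_def H_def by (rule shift_diff_quadratic_form) (rule symmetric)
  then have "F = (\<lambda>X. G X + 2 * H X)"
    by (simp add: fun_eq_iff algebra_simps)
  then have "(LINT X|?M. F X) = (LINT X|?M. G X) + 2 * (LINT X|?M. H X)"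
    using int_G int_H by simp
  moreover have "(LINT X|?M. H X) = (LINT X|surface_measure \<Omega>. g X * boundary_trace \<Omega> (shift_diff u) X)"
  proof -
    \<comment> \<open>the representatives chosen on \<open>\<Omega>1\<close> and on \<open>\<Omega>\<close> differ on a null set only\<close>
    have "AE X in ?M. \<forall>i\<in>Basis. w i X = weak_pderiv \<Omega> i u X \<and>
        shift_diff (w i) X = weak_pderiv \<Omega> i (shift_diff u) X"
    proof (intro AE_finite_allI finite_Basis)
      fix i :: "(real^'d) \<times> real" assume i: "i \<in> Basis"
      show "AE X in ?M. w i X = weak_pderiv \<Omega> i u X \<and>
          shift_diff (w i) X = weak_pderiv \<Omega> i (shift_diff u) X"
        using weak_pderiv_AE_eq[OF op wp(1)[OF i]] weak_pderiv_AE_eq[OF op wp(3)[OF i]]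
        by eventually_elim simp
    qed
    then have ae: "AE X in ?M. H X = (\<Sum>i\<in>Basis. \<Sum>j\<in>Basis.
        a i j X * weak_pderiv \<Omega> j u X * weak_pderiv \<Omega> i (shift_diff u) X)"
      by eventually_elim (simp add: H_def)
    have Qu: "shift_diff u \<in> W12 \<Omega>" and u: "u \<in> W12 \<Omega>"
      using shift_diff_W12[OF op open_\<Omega>1 \<Omega>_sub shift_sub u_W12] solution
      by (auto simp: variational_solution_def)
    have "(\<lambda>X. \<Sum>i\<in>Basis. \<Sum>j\<in>Basis. a i j X * weak_pderiv \<Omega> j u X * weak_pderiv \<Omega> i (shift_diff u) X)
        \<in> borel_measurable ?M"
      using weak_pderiv_L2[OF op Qu] weak_pderiv_L2[OF op u] a_meas
      by (intro borel_measurable_sum borel_measurable_times) (auto simp: L2_def)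
    with ae int_H have "(LINT X|?M. H X) = (LINT X|?M. (\<Sum>i\<in>Basis. \<Sum>j\<in>Basis.
        a i j X * weak_pderiv \<Omega> j u X * weak_pderiv \<Omega> i (shift_diff u) X))"
      by (intro integral_cong_AE) auto
    then show ?thesis
      using solution Qu by (simp add: variational_solution_def)
  qed
  ultimately show ?thesis
    unfolding F_def G_def w_def by simp
qed

end
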